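(* For $B\subseteq\omega$ let $M(B)=\{\sigma\in B^{<\omega} : \sigma \text{ is increasing}\}$. Then the family $$\mathcal{I}_M=\{A\subseteq\omega^{<\omega} : \text{for every infinite } F\subseteq\omega,\ M(F)\nsubseteq A\}$$ is a $\mathbf{\Pi}_1^1$-complete subset of $\mathcal{P}(\omega^{<\omega})$.
   Context: $\omega^{<\omega}$ is the (countable) set of finite sequences of natural numbers, $B^{<\omega}$ the set of finite sequences of elements of $B$; "increasing" means strictly increasing (the empty sequence counts as increasing). $\mathcal{P}(\omega^{<\omega})$ is identified with $2^{\omega^{<\omega}}$ with the product topology, and so is a Polish space homeomorphic to the Cantor space. Completeness: for Polish spaces $\mathcal{X},\mathcal{Y}$ and $A\subseteq\mathcal{X}$, $B\subseteq\mathcal{Y}$, $B$ is Borel reducible to $A$ if there is a Borel function $f:\mathcal{Y}\to\mathcal{X}$ with $f^{-1}[A]=B$. $A\subseteq\mathcal{X}$ is $\mathbf{\Sigma}_1^1$-complete if $A$ is analytic and for every Polish space $\mathcal{Y}$ every analytic $B\subseteq\mathcal{Y}$ is Borel reducible to $A$. $A\subseteq\mathcal{X}$ is $\mathbf{\Pi}_1^1$-complete if $\mathcal{X}\setminus A$ is $\mathbf{\Sigma}_1^1$-complete. *)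

theory Defs
  imports "HOL-Analysis.Analysis"
begin

section \<open>Polish spaces, analytic sets and Borel reducibility\<close>

definition Polish_space :: "'a topology \<Rightarrow> bool" where
  "Polish_space X \<longleftrightarrow> completely_metrizable_space X \<and> second_countable X"

text \<open>An analytic set is a continuous image of a Polish space. A HOL definition cannot quantify
  over types, so the Polish space is taken to live on a subset of \<^typ>\<open>nat \<Rightarrow> nat\<close>. This is no loss of
  generality, since Polish spaces have at most continuum many points; see \<open>analytic_in_image\<close> below.
  The empty topology is Polish, so the empty set is analytic.\<close>

definition analytic_in :: "'a topology \<Rightarrow> 'a set \<Rightarrow> bool" where
  "analytic_in X A \<longleftrightarrow>
     (\<exists>(P :: (nat \<Rightarrow> nat) topology) f.
        Polish_space P \<and> continuous_map P X f \<and> f ` topspace P = A)"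

lemma analytic_in_image:
  fixes P :: "'p topology"
  assumes P: "Polish_space P" and f: "continuous_map P X f"
  shows "analytic_in X (f ` topspace P)"
proof -
  obtain \<B> where \<B>: "countable \<B>" "\<And>V. V \<in> \<B> \<Longrightarrow> openin P V"
    "\<And>U x. openin P U \<Longrightarrow> x \<in> U \<Longrightarrow> \<exists>V\<in>\<B>. x \<in> V \<and> V \<subseteq> U"
    using P unfolding Polish_space_def second_countable_def by metis
  define e :: "'p \<Rightarrow> nat \<Rightarrow> nat" where
    "e = (\<lambda>p n. if p \<in> from_nat_into \<B> n then 1 else 0)"
  define g where "g = inv_into (topspace P) e"
  define Q where "Q = pullback_topology (e ` topspace P) g P"
  have t1: "t1_space P"
    using P by (simp add: Polish_space_def completely_metrizable_imp_metrizable_space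
        metrizable_imp_t1_space)
  have inj: "inj_on e (topspace P)"
  proof (rule inj_onI, rule ccontr)
    fix x y assume xy: "x \<in> topspace P" "y \<in> topspace P" "e x = e y" "x \<noteq> y"
    then obtain U where U: "openin P U" "x \<in> U" "y \<notin> U"
      using t1 unfolding t1_space_def by blast
    then obtain V where V: "V \<in> \<B>" "x \<in> V" "V \<subseteq> U" using \<B>(3) by blast
    obtain n where "from_nat_into \<B> n = V"
      using from_nat_into_surj[OF \<B>(1) V(1)] by blast
    then show False using fun_cong[OF xy(3), of n] V U by (auto simp: e_def)
  qed
  have ge: "g (e p) = p" if "p \<in> topspace P" for p
    using that inj by (simp add: g_def)
  have topQ: "topspace Q = e ` topspace P"
    using ge by (auto simp: Q_def topspace_pullback_topology)
  have contg: "continuous_map Q P g"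
    unfolding Q_def using continuous_map_pullback[OF continuous_map_id] by (simp add: o_def)
  have conte: "continuous_map P Q e"
    unfolding Q_def
  proof (rule continuous_map_pullback')
    show "continuous_map P P (g \<circ> e)"
      by (rule continuous_map_eq[OF continuous_map_id]) (simp add: ge)
  qed auto
  have hom: "homeomorphic_maps Q P g e"
    unfolding homeomorphic_maps_def using contg conte ge topQ by auto
  then have hs: "Q homeomorphic_space P"
    unfolding homeomorphic_space_def by blast
  have "Polish_space Q"
    using P homeomorphic_completely_metrizable_space[OF hs] homeomorphic_space_second_countability[OF hs]
    by (simp add: Polish_space_def)
  moreover have "continuous_map Q X (f \<circ> g)"
    using contg f by (rule continuous_map_compose)
  moreover have "(f \<circ> g) ` topspace Q = f ` topspace P"
    using ge by (force simp: topQ image_image)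
  ultimately show ?thesis unfolding analytic_in_def by blast
qed

definition borel_of :: "'a topology \<Rightarrow> 'a measure" where
  "borel_of X = sigma (topspace X) {U. openin X U}"

definition Borel_reducible :: "'b topology \<Rightarrow> 'b set \<Rightarrow> 'a topology \<Rightarrow> 'a set \<Rightarrow> bool" where
  "Borel_reducible Y B X A \<longleftrightarrow>
     (\<exists>f \<in> borel_of Y \<rightarrow>\<^sub>M borel_of X. f -` A \<inter> topspace Y = B)"

text \<open>The argument \<^typ>\<open>'b itself\<close> names the type carrying the Polish spaces \<open>Y\<close>;
  completeness in the usual sense is the statement for arbitrary \<^typ>\<open>'b\<close>.\<close>

definition Sigma11_complete :: "'b itself \<Rightarrow> 'a topology \<Rightarrow> 'a set \<Rightarrow> bool" where
  "Sigma11_complete _ X A \<longleftrightarrow>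
     Polish_space X \<and> analytic_in X A \<and>
     (\<forall>(Y :: 'b topology) B. Polish_space Y \<longrightarrow> analytic_in Y B \<longrightarrow> Borel_reducible Y B X A)"

definition Pi11_complete :: "'b itself \<Rightarrow> 'a topology \<Rightarrow> 'a set \<Rightarrow> bool" where
  "Pi11_complete T X A \<longleftrightarrow> A \<subseteq> topspace X \<and> Sigma11_complete T X (topspace X - A)"


section \<open>The power set of the finite sequences and the family\<close>

definition powerset_topology :: "'a set topology" where
  "powerset_topology =
     pullback_topology UNIV (\<lambda>A x. x \<in> A)
       (product_topology (\<lambda>_. discrete_topology (UNIV :: bool set)) UNIV)"

definition M :: "nat set \<Rightarrow> nat list set" where
  "M B = {\<sigma>. set \<sigma> \<subseteq> B \<and> sorted_wrt (<) \<sigma>}"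

definition I_M :: "nat list set set" where
  "I_M = {A. \<forall>F. infinite F \<longrightarrow> \<not> M F \<subseteq> A}"

end

theory Submission
  imports Defs "HOL-Library.Nat_Bijection"
begin

text \<open>Hardness: an analytic set \<open>B\<close> is the result of the Souslin operation on closed sets \<open>C s\<close>, so
  \<open>y \<in> B\<close> iff the tree \<open>T y = {s. y \<in> C s}\<close> has an infinite branch. Code finite sequences by numbers
  and send \<open>y\<close> to the set of those \<open>\<sigma>\<close> whose entries code pairwise prefix-comparable elements of
  \<open>T y\<close>. This set contains \<open>M F\<close> iff \<open>F\<close> codes a chain of \<open>T y\<close>, and an infinite chain amounts to an
  infinite branch.\<close>

section \<open>The power set topology: cylinders, Polishness, maps into it\<close>

lemma topspace_powerset_topology [simp]: "topspace powerset_topology = UNIV"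
  by (simp add: powerset_topology_def topspace_pullback_topology)

lemma openin_powerset_topology_UNIV: "openin powerset_topology UNIV"
  using openin_topspace[of powerset_topology] by simp

lemma openin_powerset_topology_mem:
  "openin (powerset_topology :: 'a set topology) {A. x \<in> A}"
  "openin (powerset_topology :: 'a set topology) {A. x \<notin> A}"
proof -
  let ?X = "product_topology (\<lambda>_::'a. discrete_topology (UNIV :: bool set)) UNIV"
  have "openin ?X {f \<in> topspace ?X. f x \<in> V}" for V
    by (rule openin_continuous_map_preimage[OF continuous_map_product_projection]) auto
  from this[of "{True}"] this[of "{False}"]
  show "openin (powerset_topology :: 'a set topology) {A. x \<in> A}"
    "openin (powerset_topology :: 'a set topology) {A. x \<notin> A}"
    by (auto simp: powerset_topology_def openin_pullback_topology)
qed

text \<open>A basic open box of the product restricts only finitely many coordinates.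
  \<open>F\<close> and \<open>G\<close> collect the restricted coordinates inside and outside
  \<open>A\<close>; agreeing with \<open>A\<close> on them is enough to lie in the box.\<close>

lemma powerset_topology_base:
  assumes "openin powerset_topology U" "A \<in> U"
  obtains F G where "finite F" "finite G" "A \<in> {A. F \<subseteq> A \<and> G \<inter> A = {}}"
    "{A. F \<subseteq> A \<and> G \<inter> A = {}} \<subseteq> U"
proof -
  let ?X = "product_topology (\<lambda>_::'a. discrete_topology (UNIV :: bool set)) UNIV"
  obtain W where W: "openin ?X W" "U = {A. (\<lambda>x. x \<in> A) \<in> W}"
    using assms(1) by (auto simp: powerset_topology_def openin_pullback_topology vimage_def)
  then obtain V where V: "finite {i. V i \<noteq> UNIV}" "(\<lambda>x. x \<in> A) \<in> Pi UNIV V" "Pi UNIV V \<subseteq> W"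
    using assms(2) unfolding openin_product_topology_alt by (fastforce simp: PiE_UNIV_domain)
  show thesis
  proof (rule that[of "{i. V i \<noteq> UNIV} \<inter> A" "{i. V i \<noteq> UNIV} - A"])
    show "{B. {i. V i \<noteq> UNIV} \<inter> A \<subseteq> B \<and> ({i. V i \<noteq> UNIV} - A) \<inter> B = {}} \<subseteq> U"
    proof clarify
      fix B assume B: "{i. V i \<noteq> UNIV} \<inter> A \<subseteq> B" "({i. V i \<noteq> UNIV} - A) \<inter> B = {}"
      have "(i \<in> B) \<in> V i" for i
      proof (cases "V i = UNIV")
        case False
        then have "(i \<in> B) = (i \<in> A)" using B by blast
        then show ?thesis using V(2) by (simp add: Pi_iff)
      qed simp
      then show "B \<in> U" using V(3) W(2) by auto
    qed
  qed (use V(1) in auto)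
qed

text \<open>A countable type has only countably many pairs of finite subsets, so all cylinders
  inside \<open>U\<close> can be taken at once. This reduces Borel measurability to
  cylinders.\<close>

lemma openin_powerset_topology_countable_union:
  fixes U :: "'a::countable set set"
  assumes "openin powerset_topology U"
  obtains I where "countable I" "\<And>F G. (F, G) \<in> I \<Longrightarrow> finite F \<and> finite G"
    "U = (\<Union>(F, G)\<in>I. {A. F \<subseteq> A \<and> G \<inter> A = {}})"
proof
  let ?I = "{(F, G). finite F \<and> finite G \<and> {A. F \<subseteq> A \<and> G \<inter> A = {}} \<subseteq> U}"
  have "countable (Collect finite \<times> Collect finite :: ('a set \<times> 'a set) set)"
    by (intro countable_SIGMA countable_Collect_finite)
  then show "countable ?I" by (rule countable_subset[rotated]) auto
  have "\<exists>i\<in>?I. A \<in> (case i of (F, G) \<Rightarrow> {A. F \<subseteq> A \<and> G \<inter> A = {}})" if A: "A \<in> U" for A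
  proof -
    obtain F G where "finite F" "finite G" "A \<in> {A. F \<subseteq> A \<and> G \<inter> A = {}}"
      "{A. F \<subseteq> A \<and> G \<inter> A = {}} \<subseteq> U"
      by (rule powerset_topology_base[OF assms A])
    then show ?thesis by (intro bexI[of _ "(F, G)"]) simp_all
  qed
  then show "U = (\<Union>(F, G)\<in>?I. {A. F \<subseteq> A \<and> G \<inter> A = {}})"
    by (intro equalityI subsetI) (simp_all only: UN_iff, auto)
qed simp

lemma openin_powerset_topology_cylinder:
  assumes "finite F" "finite G"
  shows "openin powerset_topology {A. F \<subseteq> A \<and> G \<inter> A = {}}"
proof -
  \<comment> \<open>Inserting \<open>UNIV\<close> keeps the intersected family nonempty when
    \<open>F\<close> and \<open>G\<close> are both empty.\<close>
  have "openin powerset_topology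
      (\<Inter> (insert UNIV ((\<lambda>x. {A. x \<in> A}) ` F \<union> (\<lambda>x. {A. x \<notin> A}) ` G)))"
    using assms by (intro openin_Inter)
      (auto intro: openin_powerset_topology_mem openin_powerset_topology_UNIV)
  also have "\<Inter> (insert UNIV ((\<lambda>x. {A. x \<in> A}) ` F \<union> (\<lambda>x. {A. x \<notin> A}) ` G))
      = {A. F \<subseteq> A \<and> G \<inter> A = {}}"
    by auto
  finally show ?thesis .
qed

lemma second_countable_powerset_topology:
  "second_countable (powerset_topology :: 'a::countable set topology)"
proof -
  let ?c = "\<lambda>(F, G). {A. F \<subseteq> A \<and> G \<inter> A = {}} :: 'a set set"
  let ?B = "?c ` (Collect finite \<times> Collect finite)"
  have "countable ?B"
    by (intro countable_image countable_SIGMA countable_Collect_finite)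
  moreover have "openin powerset_topology V" if "V \<in> ?B" for V
    using that openin_powerset_topology_cylinder by auto
  moreover have "\<exists>V\<in>?B. A \<in> V \<and> V \<subseteq> U" if U: "openin powerset_topology U" "A \<in> U" for U A
  proof -
    obtain F G where FG: "finite F" "finite G" "A \<in> ?c (F, G)" "?c (F, G) \<subseteq> U"
      using powerset_topology_base[OF U] by auto
    then have "?c (F, G) \<in> ?B" by blast
    with FG(3,4) show ?thesis by (intro bexI[of _ "?c (F, G)"] conjI)
  qed
  ultimately show ?thesis
    unfolding second_countable_def by (intro exI[of _ ?B] conjI ballI allI impI) simp_all
qed

text \<open>Complete metrizability is carried over from a countable power of the two-point discrete
  space, along the homeomorphism sending a set to its characteristic function.\<close>

lemma Polish_space_powerset_topology:
  "Polish_space (powerset_topology :: 'a::countable set topology)"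
proof -
  let ?X = "product_topology (\<lambda>_::'a. discrete_topology (UNIV :: bool set)) UNIV"
  have *: "(\<lambda>A x. x \<in> A) \<circ> Collect = (\<lambda>f. f)" by auto
  have "homeomorphic_maps powerset_topology ?X (\<lambda>A x. x \<in> A) Collect"
    unfolding homeomorphic_maps_def powerset_topology_def
    using continuous_map_pullback[OF continuous_map_id, of UNIV "\<lambda>A x. x \<in> A" ?X]
    by (auto simp: o_def id_def intro!: continuous_map_pullback' simp: *[unfolded o_def])
  then have "(powerset_topology :: 'a set topology) homeomorphic_space ?X"
    unfolding homeomorphic_space_def by blast
  moreover have "completely_metrizable_space ?X"
    by (auto simp: completely_metrizable_space_product_topology
        completely_metrizable_space_discrete_topology)
  ultimately show ?thesis
    using homeomorphic_completely_metrizable_space second_countable_powerset_topology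
    unfolding Polish_space_def by blast
qed

lemma continuous_map_powerset_topology:
  assumes "\<And>x. openin X {p \<in> topspace X. x \<in> g p}" "\<And>x. openin X {p \<in> topspace X. x \<notin> g p}"
  shows "continuous_map X powerset_topology g"
  unfolding powerset_topology_def
proof (rule continuous_map_pullback')
  have "openin X {p \<in> topspace X. (x \<in> g p) \<in> V}" for x V
  proof -
    have "{p \<in> topspace X. (x \<in> g p) \<in> V} =
        (if True \<in> V then {p \<in> topspace X. x \<in> g p} else {}) \<union>
        (if False \<in> V then {p \<in> topspace X. x \<notin> g p} else {})"
      by auto (metis (full_types))+
    then show ?thesis using assms by auto
  qed
  then show "continuous_map X (product_topology (\<lambda>_. discrete_topology UNIV) UNIV)
      ((\<lambda>A x. x \<in> A) \<circ> g)"
    by (subst continuous_map_componentwise_UNIV) (simp add: continuous_map_def)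
qed auto

text \<open>Preimages of cylinders are finite Boolean combinations of the assumed measurable sets,
  and open sets are countable unions of cylinders. Complements come for free, so a single condition
  replaces the two needed for continuity.\<close>

lemma measurable_powerset_topology:
  fixes g :: "'b \<Rightarrow> 'a::countable set"
  assumes "\<And>x. {y \<in> space N. x \<in> g y} \<in> sets N"
  shows "g \<in> N \<rightarrow>\<^sub>M borel_of powerset_topology"
  unfolding borel_of_def
proof (rule measurable_sigma_sets[where A="Collect (openin powerset_topology)"])
  fix U :: "'a set set" assume "U \<in> Collect (openin powerset_topology)"
  then have "openin powerset_topology U" by simp
  then obtain I where I: "countable I" "\<And>F G. (F, G) \<in> I \<Longrightarrow> finite F \<and> finite G"
    "U = (\<Union>(F, G)\<in>I. {A. F \<subseteq> A \<and> G \<inter> A = {}})"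
    by (rule openin_powerset_topology_countable_union) blast
  have "g -` U \<inter> space N =
      (\<Union>(F, G)\<in>I. {y \<in> space N. (\<forall>x\<in>F. x \<in> g y) \<and> (\<forall>x\<in>G. \<not> x \<in> g y)})"
    unfolding I(3) by blast
  also have "\<dots> \<in> sets N"
    using I(2) assms
    by (intro sets.countable_UN'[OF I(1)])
      (auto intro!: sets.sets_Collect_conj sets.sets_Collect_finite_All' sets.sets_Collect_neg
        sets.sets_Collect_finite_All)
  finally show "g -` U \<inter> space N \<in> sets N" .
qed (auto simp: sets_measure_of)

section \<open>The complement of \<open>I_M\<close> is analytic\<close>

lemma Polish_space_gdelta_subtopology:
  assumes "Polish_space X" "gdelta_in X S"
  shows "Polish_space (subtopology X S)"
  using assms by (simp add: Polish_space_def completely_metrizable_space_gdelta_in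
      second_countable_subtopology)

text \<open>A set outside \<^const>\<open>I_M\<close> is \<open>M F \<union> A'\<close> for an infinite \<open>F\<close> and an arbitrary \<open>A'\<close>;
  the pair \<open>(F, A')\<close> is coded by the disjoint sum \<open>F <+> A'\<close>.\<close>

lemma analytic_in_compl_I_M: "analytic_in powerset_topology (- I_M)"
proof -
  let ?P = "powerset_topology :: (nat + nat list) set topology"
  define S where "S = {A :: (nat + nat list) set. infinite (Inl -` A)}"
  define g where "g = (\<lambda>A :: (nat + nat list) set. M (Inl -` A) \<union> Inr -` A)"
  \<comment> \<open>Infinite means unbounded in the naturals, which is a countable intersection of
    open conditions.\<close>
  have "S = (\<Inter>m. \<Union>n\<in>{m..}. {A. Inl n \<in> A})"
    by (auto simp: S_def infinite_nat_iff_unbounded_le)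
  moreover have "gdelta_in ?P (\<Union>n\<in>{m..}. {A. Inl n \<in> A})" for m
    by (intro open_imp_gdelta_in openin_Union) (auto intro: openin_powerset_topology_mem)
  ultimately have S: "gdelta_in ?P S"
    by (auto intro: gdelta_in_Inter)
  \<comment> \<open>Whether \<open>\<sigma>\<close> lies in \<open>g A\<close> depends only on
    whether \<open>A\<close> contains \<open>Inr \<sigma>\<close> and the finitely many
    \<open>Inl n\<close> with \<open>n\<close> an entry of \<open>\<sigma>\<close>.\<close>
  have opens: "openin ?P {A. \<sigma> \<in> g A}" "openin ?P {A. \<sigma> \<notin> g A}" for \<sigma>
  proof -
    have "{A. \<sigma> \<in> g A} = {A. {Inr \<sigma>} \<subseteq> A \<and> {} \<inter> A = {}} \<union>
        (if sorted_wrt (<) \<sigma> then {A. Inl ` set \<sigma> \<subseteq> A \<and> {} \<inter> A = {}} else {})"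
      by (auto simp: g_def M_def)
    also have "openin ?P \<dots>"
      by (intro openin_Un) (auto intro!: openin_powerset_topology_cylinder[of _ "{}", simplified]
          openin_powerset_topology_mem)
    finally show "openin ?P {A. \<sigma> \<in> g A}" .
    have "{A. \<sigma> \<notin> g A} = {A. Inr \<sigma> \<notin> A} \<inter>
        (if sorted_wrt (<) \<sigma> then \<Union>n\<in>set \<sigma>. {A. Inl n \<notin> A} else topspace ?P)"
      by (auto simp: g_def M_def)
    also have "openin ?P \<dots>"
      by (intro openin_Int) (auto intro!: openin_powerset_topology_mem
          openin_powerset_topology_UNIV openin_Union)
    finally show "openin ?P {A. \<sigma> \<notin> g A}" .
  qed
  have cont: "continuous_map (subtopology ?P S) powerset_topology g"
    by (rule continuous_map_from_subtopology, rule continuous_map_powerset_topology)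
      (simp_all add: opens)
  have "g ` S = - I_M"
  proof safe
    fix A assume "A \<in> S" "g A \<in> I_M"
    then show False by (auto simp: S_def g_def I_M_def)
  next
    fix A assume "A \<notin> I_M"
    then obtain F where F: "infinite F" "M F \<subseteq> A" by (auto simp: I_M_def)
    \<comment> \<open>Since \<open>M F\<close> is already contained in \<open>A\<close>, uniting the
      two gives back \<open>A\<close>.\<close>
    have "Inl -` (F <+> A) = F" "Inr -` (F <+> A) = A" by auto
    then have "F <+> A \<in> S" "g (F <+> A) = A" using F by (auto simp: S_def g_def)
    then show "A \<in> g ` S" by (metis imageI)
  qed
  then show ?thesis
    using analytic_in_image[OF Polish_space_gdelta_subtopology[OF Polish_space_powerset_topology S] cont]
    by (simp add: topspace_subtopology)
qed

section \<open>Souslin schemes for analytic sets\<close>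

text \<open>The entries of \<open>s\<close> select centres in a countable dense set, and
  \<open>E s\<close> intersects the closed balls of radii \<open>(1/2) ^ i\<close> about them. Along
  a branch with all sets nonempty, completeness yields a common point, and the shrinking radii force
  the sets into each of its neighbourhoods.\<close>

lemma Polish_space_scheme:
  assumes "Polish_space P"
  obtains E :: "nat list \<Rightarrow> 'a set" where
    "\<And>s. E s \<subseteq> topspace P"
    "\<And>s n. E s \<subseteq> E (take n s)"
    "\<And>p. p \<in> topspace P \<Longrightarrow> \<exists>x. \<forall>n. p \<in> E (map x [0..<n])"
    "\<And>x. (\<And>n. E (map x [0..<n]) \<noteq> {}) \<Longrightarrow> \<exists>p. (\<forall>n. p \<in> E (map x [0..<n])) \<and>
       (\<forall>U. openin P U \<longrightarrow> p \<in> U \<longrightarrow> (\<exists>n. E (map x [0..<n]) \<subseteq> U))"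
proof -
  obtain S d where "Metric_space S d" and compl: "Metric_space.mcomplete S d"
    and P: "P = Metric_space.mtopology S d"
    using assms unfolding Polish_space_def completely_metrizable_space_def by blast
  then interpret Metric_space S d by blast
  obtain D where D: "countable D" "D \<subseteq> S" "mtopology closure_of D = S"
    using assms second_countable_imp_separable_space
    unfolding Polish_space_def separable_space_def P by force
  define q where "q = from_nat_into D"
  \<comment> \<open>The factor \<open>S\<close> matters for the empty sequence, where no ball is
    intersected.\<close>
  define E where "E = (\<lambda>s. S \<inter> (\<Inter>i<length s. mcball (q (s ! i)) ((1/2) ^ i)))"
  have E_take: "E s \<subseteq> E (take n s)" for s n
    by (auto simp: E_def)
  show thesis
  proof (rule that[of E])
    show "E s \<subseteq> topspace P" for s by (auto simp: E_def P)
    show "E s \<subseteq> E (take n s)" for s n by (rule E_take)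
  next
    fix p assume "p \<in> topspace P"
    then have p: "p \<in> S" by (simp add: P)
    have "\<exists>k. p \<in> mcball (q k) ((1/2) ^ i)" for i :: nat
    proof -
      have "p \<in> mtopology closure_of D" using p D(3) by simp
      then have "\<exists>y\<in>D. y \<in> mball p ((1/2) ^ i)"
        unfolding metric_closure_of by (simp add: in_mball)
      then obtain y where y: "y \<in> D" "y \<in> mball p ((1/2) ^ i)" by blast
      obtain k where "q k = y"
        using from_nat_into_surj[OF D(1) y(1)] by (auto simp: q_def)
      then show ?thesis using y(2) by (auto simp: commute)
    qed
    then obtain x where "\<And>i. p \<in> mcball (q (x i)) ((1/2) ^ i)" by metis
    then show "\<exists>x. \<forall>n. p \<in> E (map x [0..<n])"
      using p by (intro exI[of _ x]) (auto simp: E_def)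
  next
    fix x :: "nat \<Rightarrow> nat" assume ne: "\<And>n. E (map x [0..<n]) \<noteq> {}"
    let ?C = "\<lambda>n. E (map x [0..<n])"
    have closed: "closedin mtopology (?C n)" for n
    proof -
      \<comment> \<open>Again \<open>S\<close> keeps the family nonempty, here for
        \<open>n = 0\<close>.\<close>
      let ?K = "insert S ((\<lambda>i. mcball (q (x i)) ((1/2) ^ i)) ` {..<n})"
      have "closedin mtopology S" using closedin_topspace[of mtopology] by simp
      then have "closedin mtopology (\<Inter> ?K)" by (intro closedin_Inter) auto
      also have "\<Inter> ?K = ?C n" by (auto simp: E_def)
      finally show ?thesis .
    qed
    have dec: "decseq ?C"
      unfolding decseq_def
    proof (intro allI impI)
      fix m n :: nat assume "m \<le> n"
      then have "take m (map x [0..<n]) = map x [0..<m]" by (simp add: take_map)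
      then show "?C n \<subseteq> ?C m" using E_take by metis
    qed
    \<comment> \<open>The ball with index \<open>n\<close> enters only at length
      \<open>Suc n\<close>.\<close>
    have small: "?C (Suc n) \<subseteq> mcball (q (x n)) ((1/2) ^ n)" for n
      by (auto simp: E_def simp del: upt_Suc)
    have pow: "\<exists>n. (1/2) ^ n < e" if "e > 0" for e :: real
      using real_arch_pow_inv[OF that] by simp
    have "\<exists>n a. ?C n \<subseteq> mcball a e" if "e > 0" for e
    proof -
      obtain n where "(1/2) ^ n < e" using pow \<open>e > 0\<close> by blast
      then have "?C (Suc n) \<subseteq> mcball (q (x n)) e"
        using small[of n] mcball_subset_concentric[of "(1/2) ^ n" e] by force
      then show ?thesis by blast
    qed
    then have "\<Inter> (range ?C) \<noteq> {}"
      using compl closed ne dec unfolding mcomplete_nest by metis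
    then obtain p where p: "p \<in> ?C n" for n by blast
    have "\<exists>n. ?C n \<subseteq> U" if "openin P U" "p \<in> U" for U
    proof -
      obtain r where r: "r > 0" "mball p r \<subseteq> U"
        using \<open>openin P U\<close> \<open>p \<in> U\<close> unfolding P openin_mtopology by blast
      obtain n where n: "(1/2) ^ n < r / 2" using pow[of "r / 2"] r(1) by auto
      \<comment> \<open>Both \<open>p\<close> and \<open>z\<close> are within \<open>r / 2\<close>
        of the centre \<open>q (x n)\<close>.\<close>
      have "z \<in> mball p r" if "z \<in> ?C (Suc n)" for z
      proof -
        have "d (q (x n)) p \<le> (1/2) ^ n" "d (q (x n)) z \<le> (1/2) ^ n"
          "q (x n) \<in> S" "p \<in> S" "z \<in> S"
          using small[of n] p[of "Suc n"] that by (auto simp del: upt_Suc)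
        then show ?thesis using n triangle'[of p "q (x n)" z] by (simp add: commute)
      qed
      then show ?thesis using r(2) by blast
    qed
    with p show "\<exists>p. (\<forall>n. p \<in> ?C n) \<and> (\<forall>U. openin P U \<longrightarrow> p \<in> U \<longrightarrow> (\<exists>n. ?C n \<subseteq> U))"
      by blast
  qed
qed

text \<open>Taking closures of the images of the scheme makes the sets closed without adding points
  to the result: along a branch the scheme converges to some \<open>p\<close>, so by continuity the
  images shrink to \<open>f p\<close>, and in a Hausdorff space no other point lies in all the
  closures.\<close>

lemma analytic_in_Souslin:
  assumes Y: "Hausdorff_space Y" and B: "analytic_in Y B"
  obtains C :: "nat list \<Rightarrow> 'a set" where
    "\<And>s. closedin Y (C s)"
    "\<And>s n. C s \<subseteq> C (take n s)"
    "\<And>y. y \<in> B \<longleftrightarrow> (\<exists>x. \<forall>n. y \<in> C (map x [0..<n]))"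
proof -
  obtain P :: "(nat \<Rightarrow> nat) topology" and f where
    P: "Polish_space P" and f: "continuous_map P Y f" and B: "B = f ` topspace P"
    using B unfolding analytic_in_def by blast
  obtain E :: "nat list \<Rightarrow> (nat \<Rightarrow> nat) set" where E:
    "\<And>s. E s \<subseteq> topspace P"
    "\<And>s n. E s \<subseteq> E (take n s)"
    "\<And>p. p \<in> topspace P \<Longrightarrow> \<exists>x. \<forall>n. p \<in> E (map x [0..<n])"
    "\<And>x. (\<And>n. E (map x [0..<n]) \<noteq> {}) \<Longrightarrow> \<exists>p. (\<forall>n. p \<in> E (map x [0..<n])) \<and>
       (\<forall>U. openin P U \<longrightarrow> p \<in> U \<longrightarrow> (\<exists>n. E (map x [0..<n]) \<subseteq> U))"
    using Polish_space_scheme[OF P] by blast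
  define C where "C = (\<lambda>s. Y closure_of (f ` E s))"
  show thesis
  proof (rule that[of C])
    show "closedin Y (C s)" for s by (simp add: C_def)
    show "C s \<subseteq> C (take n s)" for s n
      unfolding C_def by (intro closure_of_mono image_mono E)
    fix y
    show "y \<in> B \<longleftrightarrow> (\<exists>x. \<forall>n. y \<in> C (map x [0..<n]))"
    proof
      assume "y \<in> B"
      then obtain p where p: "p \<in> topspace P" "y = f p" using B by blast
      have "f ` E s \<subseteq> C s" for s
        unfolding C_def using E(1) f[THEN continuous_map_funspace] by (intro closure_of_subset) auto
      then show "\<exists>x. \<forall>n. y \<in> C (map x [0..<n])"
        using E(3)[OF p(1)] p(2) by blast
    next
      assume "\<exists>x. \<forall>n. y \<in> C (map x [0..<n])"
      then obtain x where x: "\<And>n. y \<in> C (map x [0..<n])" by blast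
      \<comment> \<open>A nonempty closure has a nonempty base set, which is all that the
        convergence property of the scheme requires.\<close>
      then have "E (map x [0..<n]) \<noteq> {}" for n
        by (metis C_def closure_of_empty empty_iff image_empty)
      then obtain p where p: "\<And>n. p \<in> E (map x [0..<n])"
        "\<And>U. openin P U \<Longrightarrow> p \<in> U \<Longrightarrow> \<exists>n. E (map x [0..<n]) \<subseteq> U"
        using E(4)[of x] by blast
      have pP: "p \<in> topspace P" using p(1) E(1) by blast
      have "y = f p"
      proof (rule ccontr)
        assume "y \<noteq> f p"
        moreover have "y \<in> topspace Y" using x by (auto simp: C_def in_closure_of)
        moreover have "f p \<in> topspace Y" using pP f[THEN continuous_map_funspace] by auto
        ultimately obtain V U where UV: "openin Y V" "openin Y U" "y \<in> V" "f p \<in> U" "disjnt V U"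
          using Y unfolding Hausdorff_space_def by metis
        have "openin P {z \<in> topspace P. f z \<in> U}"
          using f UV(2) by (rule openin_continuous_map_preimage)
        then obtain n where n: "E (map x [0..<n]) \<subseteq> {z \<in> topspace P. f z \<in> U}"
          using p(2) UV(4) pP by blast
        obtain z where "z \<in> f ` E (map x [0..<n])" "z \<in> V"
          using x[of n] UV(1,3) unfolding C_def in_closure_of by blast
        then show False using n UV(5) by (auto simp: disjnt_iff)
      qed
      then show "y \<in> B" using pP B by blast
    qed
  qed
qed

section \<open>Chains in trees and infinite branches\<close>

text \<open>Only the set of entries of \<open>\<sigma>\<close> matters, so the numerical order of
  the codes is irrelevant. \<open>T\<close> enters only through finitely many membership conditions,
  which keeps the reduction Borel.\<close>

definition chain_seqs :: "nat list set \<Rightarrow> nat list set" where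
  "chain_seqs T = {\<sigma>. \<forall>a\<in>set \<sigma>. list_decode a \<in> T \<and>
     (\<forall>b\<in>set \<sigma>. length (list_decode a) \<le> length (list_decode b) \<longrightarrow>
        take (length (list_decode a)) (list_decode b) = list_decode a)}"

text \<open>An infinite chain of a tree under the prefix order has unbounded lengths, so it determines
  a branch; conversely the initial segments of a branch form such a chain.\<close>

lemma chain_seqs_in_I_M_iff:
  assumes tree: "\<And>s n. s \<in> T \<Longrightarrow> take n s \<in> T"
  shows "chain_seqs T \<notin> I_M \<longleftrightarrow> (\<exists>x. \<forall>n. map x [0..<n] \<in> T)"
proof
  assume "chain_seqs T \<notin> I_M"
  then obtain F where F: "infinite F" "M F \<subseteq> chain_seqs T" by (auto simp: I_M_def)
  let ?S = "list_decode ` F"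
  have pair: "list_decode a \<in> T \<and> (length (list_decode a) \<le> length (list_decode b) \<longrightarrow>
        take (length (list_decode a)) (list_decode b) = list_decode a)"
    if "a \<in> F" "b \<in> F" for a b
  proof -
    \<comment> \<open>Members of \<open>M F\<close> with at most two entries already test every
      pair; they must list the pair in increasing order.\<close>
    have "\<exists>\<sigma>\<in>M F. set \<sigma> = {a, b}"
    proof (cases a b rule: linorder_cases)
      case less
      then show ?thesis using that by (intro bexI[of _ "[a, b]"]) (auto simp: M_def)
    next
      case equal
      then show ?thesis using that by (intro bexI[of _ "[a]"]) (auto simp: M_def)
    next
      case greater
      then show ?thesis using that by (intro bexI[of _ "[b, a]"]) (auto simp: M_def)
    qed
    then show ?thesis using F(2) by (auto simp: chain_seqs_def)
  qed
  have S_T: "?S \<subseteq> T" using pair by blast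
  have chain: "take (length s) t = s" if "s \<in> ?S" "t \<in> ?S" "length s \<le> length t" for s t
    using that pair by blast
  have "infinite ?S" using F(1) finite_imageD[OF _ inj_list_decode] by blast
  \<comment> \<open>Comparable sequences of equal length coincide.\<close>
  moreover have "inj_on length ?S" using chain by (intro inj_onI) (metis order_refl take_all)
  ultimately have "infinite (length ` ?S)" using finite_imageD by blast
  then have "\<exists>s\<in>?S. n < length s" for n
    by (metis (no_types, lifting) imageE infinite_nat_iff_unbounded)
  then obtain t where t: "\<And>n. t n \<in> ?S" "\<And>n. n < length (t n)" by metis
  \<comment> \<open>The choice of \<open>t i\<close> among the chain elements longer than
    \<open>i\<close> is immaterial: all of them agree at position \<open>i\<close>. Hence the
    diagonal sequence of the \<open>t i ! i\<close> is a branch.\<close>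
  have nth: "s ! i = t i ! i" if "s \<in> ?S" "i < length s" for s i
  proof (cases "length s \<le> length (t i)")
    case True
    then show ?thesis using chain[OF that(1) t(1) True] nth_take[OF that(2), of "t i"] by simp
  next
    case False
    then show ?thesis
      using chain[OF t(1) that(1), of i] nth_take[OF t(2)[of i], of s] by simp
  qed
  have "map (\<lambda>i. t i ! i) [0..<n] = take n (t n)" for n
    using t(2)[of n] by (intro nth_equalityI) (auto simp: nth[OF t(1)])
  then show "\<exists>x. \<forall>n. map x [0..<n] \<in> T"
    using tree S_T t(1) by (metis subsetD)
next
  assume "\<exists>x. \<forall>n. map x [0..<n] \<in> T"
  then obtain x where x: "\<And>n. map x [0..<n] \<in> T" by blast
  let ?F = "range (\<lambda>n. list_encode (map x [0..<n]))"
  have "inj (\<lambda>n. list_encode (map x [0..<n]))"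
    by (rule injI) (metis diff_zero length_map length_upt list_encode_inverse)
  then have "infinite ?F" by (rule range_inj_infinite)
  moreover have "M ?F \<subseteq> chain_seqs T"
  proof
    fix \<sigma> assume "\<sigma> \<in> M ?F"
    then have *: "\<exists>n. a = list_encode (map x [0..<n])" if "a \<in> set \<sigma>" for a
      using that by (auto simp: M_def)
    show "\<sigma> \<in> chain_seqs T"
      unfolding chain_seqs_def
    proof (intro CollectI ballI conjI impI)
      fix a assume a: "a \<in> set \<sigma>"
      show "list_decode a \<in> T" using *[OF a] x by auto
      fix b assume b: "b \<in> set \<sigma>" and le: "length (list_decode a) \<le> length (list_decode b)"
      show "take (length (list_decode a)) (list_decode b) = list_decode a"
        using *[OF a] *[OF b] le by (auto simp: take_map)
    qed
  qed
  ultimately show "chain_seqs T \<notin> I_M" by (auto simp: I_M_def)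
qed

section \<open>The Borel reduction\<close>

lemma space_borel_of [simp]: "space (borel_of X) = topspace X"
  by (simp add: borel_of_def space_measure_of_conv)

lemma borel_of_closedin:
  assumes "closedin X S"
  shows "S \<in> sets (borel_of X)"
proof -
  have "topspace X - S \<in> sets (borel_of X)"
    using assms openin_subset unfolding borel_of_def closedin_def
    by (subst sets_measure_of) (auto intro: sigma_sets.Basic)
  then have "topspace X - (topspace X - S) \<in> sets (borel_of X)"
    using sets.compl_sets[of "topspace X - S" "borel_of X"] by simp
  then show ?thesis using closedin_subset[OF assms] by (simp add: double_diff)
qed

lemma Borel_reducible_compl_I_M:
  assumes Y: "Polish_space Y" and B: "analytic_in Y B"
  shows "Borel_reducible Y B powerset_topology (- I_M)"
proof -
  have "Hausdorff_space Y"
    using Y by (simp add: Polish_space_def completely_metrizable_imp_metrizable_space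
        metrizable_imp_Hausdorff_space)
  then obtain C :: "nat list \<Rightarrow> 'a set" where C:
    "\<And>s. closedin Y (C s)"
    "\<And>s n. C s \<subseteq> C (take n s)"
    "\<And>y. y \<in> B \<longleftrightarrow> (\<exists>x. \<forall>n. y \<in> C (map x [0..<n]))"
    using analytic_in_Souslin[OF _ B] by blast
  define f where "f = (\<lambda>y. chain_seqs {s. y \<in> C s})"
  have "{y \<in> topspace Y. \<sigma> \<in> f y} \<in> sets (borel_of Y)" for \<sigma>
  proof (rule borel_of_closedin)
    \<comment> \<open>Comparability of the entries does not depend on \<open>y\<close> and is split
      off as membership in \<open>chain_seqs UNIV\<close>. What remains is a finite intersection of
      closed sets, equal to \<open>topspace Y\<close> for the empty sequence.\<close>
    have "{y \<in> topspace Y. \<sigma> \<in> f y} =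
        (if \<sigma> \<in> chain_seqs UNIV then topspace Y \<inter> (\<Inter>a\<in>set \<sigma>. C (list_decode a)) else {})"
      by (auto simp: f_def chain_seqs_def)
    also have "closedin Y \<dots>"
    proof (cases "set \<sigma> = {}")
      case False
      then have "closedin Y (\<Inter>a\<in>set \<sigma>. C (list_decode a))"
        using C(1) by (intro closedin_INT) auto
      then show ?thesis by auto
    qed auto
    finally show "closedin Y {y \<in> topspace Y. \<sigma> \<in> f y}" .
  qed
  then have "f \<in> borel_of Y \<rightarrow>\<^sub>M borel_of powerset_topology"
    by (intro measurable_powerset_topology) simp
  moreover have "f y \<notin> I_M \<longleftrightarrow> y \<in> B" for y
    unfolding f_def C(3) using C(2) by (subst chain_seqs_in_I_M_iff) auto
  \<comment> \<open>Needed because the preimage in \<open>Borel_reducible\<close> is cut down to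
    \<open>topspace Y\<close>.\<close>
  moreover have "B \<subseteq> topspace Y"
    using C(1)[THEN closedin_subset] C(3) by blast
  ultimately show ?thesis
    unfolding Borel_reducible_def by (intro bexI[of _ f]) auto
qed

theorem theorem3p1:
  shows "Pi11_complete TYPE('b) (powerset_topology :: nat list set topology) I_M"
  by (simp add: Pi11_complete_def Sigma11_complete_def Polish_space_powerset_topology
      analytic_in_compl_I_M Borel_reducible_compl_I_M flip: Compl_eq_Diff_UNIV)

end
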